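(* Let $G$ be a finite simple graph such that $G$ contains no induced subgraph isomorphic to the path $P_5$ on five vertices, and such that every vertex of $G$ has degree at least $3$. Then $G$ contains a cycle of length $4$ (not necessarily induced).
   Context: All graphs are finite, undirected and simple. $P_k$ denotes the path on $k$ vertices. A graph is $H$-free if it has no induced subgraph isomorphic to $H$. *)

theory Defs
  imports "Graph_Theory.Graph_Theory"
begin

text \<open>
  Undirected simple graphs are the \<^locale>\<open>graph\<close>s of Graph_Theory: finite symmetric
  digraphs without loops or parallel arcs, an undirected edge being a pair of opposite arcs.
  Hence the degree of a vertex is its \<^const>\<open>out_degree\<close>, and a
  \<^const>\<open>pre_digraph.cycle\<close> of length at least 3 is a cycle of the undirected graph
  (of length 2 it may be an edge traversed back and forth).
\<close>

text \<open>The index is the number of vertices, not of edges.\<close>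

definition path_graph :: "nat \<Rightarrow> nat pair_pre_digraph" where
  "path_graph k = \<lparr> pverts = {..<k},
     parcs = {(i, j). i < k \<and> j < k \<and> (j = Suc i \<or> i = Suc j)} \<rparr>"

lemma pair_graph_path_graph: "pair_graph (path_graph k)"
proof
  have "parcs (path_graph k) \<subseteq> {..<k} \<times> {..<k}"
    by (auto simp: path_graph_def)
  then show "finite (parcs (path_graph k))"
    by (rule finite_subset) simp
qed (auto simp: path_graph_def symmetric_def sym_def arcs_ends_def arc_to_ends_def)

definition induced_free :: "('a, 'b) pre_digraph \<Rightarrow> ('c, 'd) pre_digraph \<Rightarrow> bool" where
  "induced_free G H \<longleftrightarrow> \<not> (\<exists>K. induced_subgraph K G \<and> digraph_iso K H)"

end

(* Suppose there is no 4-cycle, so that two vertices have at most one common neighbour. An induced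
   path a b c d forces every neighbour of d other than c to be adjacent to a or to c, since otherwise
   it extends to an induced P5. At most one such neighbour is adjacent to a and at most one to c, so
   d has neighbours x ~ a and y ~ c. The same argument for the induced path x a b c shows y ~ x
   or y ~ b, and either closes a 4-cycle. Hence there is no induced P4; but two non-adjacent
   neighbours of a vertex v, one of which has a neighbour outside N(v) and different from v, give one. *)

theory Submission
  imports Defs
begin

text \<open>The combinatorics runs on a bare adjacency relation, away from arcs. In
  \<open>P5_free\<close>, the premises with \<open>\<not> E a e\<close> already force five distinct
  vertices.\<close>

context
  fixes E :: "'a \<Rightarrow> 'a \<Rightarrow> bool"
  assumes sym: "E x y \<Longrightarrow> E y x"
    and irrefl: "\<not> E x x"
    and C4_free: "\<lbrakk>E a b; E b c; E c d; E d a\<rbrakk> \<Longrightarrow> a = c \<or> b = d"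
    and P5_free: "\<lbrakk>E a b; E b c; E c d; E d e; \<not> E a c; \<not> E a d; \<not> E b d; \<not> E b e; \<not> E c e\<rbrakk>
      \<Longrightarrow> E a e"
    and two_further_neighbours: "E u v \<Longrightarrow> \<exists>x y. x \<noteq> y \<and> x \<noteq> u \<and> y \<noteq> u \<and> E v x \<and> E v y"
begin

text \<open>An edge from \<open>x\<close> to \<open>b\<close> would close the 4-cycle
  \<open>b c d x\<close>; so if \<open>x\<close> also missed \<open>a\<close> and \<open>c\<close>,
  then \<open>a b c d x\<close> would be an induced path.\<close>

lemma neighbour_of_P4_end:
  assumes "E a b" "E b c" "E c d" "\<not> E a c" "\<not> E a d" "\<not> E b d" "E d x" "x \<noteq> c"
  shows "E x a \<or> E x c"
proof -
  have "b \<noteq> d" using assms by auto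
  then have "\<not> E b x" using C4_free[of b c d x] assms sym by blast
  then show ?thesis using P5_free[of a b c d x] assms sym by blast
qed

lemma no_induced_P4:
  assumes "E a b" "E b c" "E c d" "\<not> E a c" "\<not> E a d" "\<not> E b d"
  shows False
proof -
  have distinct: "b \<noteq> d" "a \<noteq> d" "a \<noteq> c" using assms sym by auto
  have one_nbr: "u = v" if "E d u" "E d v" "E w u" "E w v" "w \<noteq> d" for u v w
    using C4_free[of d u w v] that sym by blast
  obtain p q where "p \<noteq> q" "p \<noteq> c" "q \<noteq> c" "E d p" "E d q"
    using two_further_neighbours assms(3) by blast
  moreover from this have "E p a \<or> E p c" "E q a \<or> E q c"
    using neighbour_of_P4_end[OF assms] by auto
  moreover have "c \<noteq> d" using assms(3) irrefl by auto
  \<comment> \<open>By \<open>one_nbr\<close>, \<open>p\<close> and \<open>q\<close> are neither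
    both adjacent to \<open>a\<close> nor both to \<open>c\<close>, so each of \<open>a\<close> and
    \<open>c\<close> gets one of them.\<close>
  ultimately obtain x y where xy: "E d x" "E d y" "E x a" "E y c" "x \<noteq> c" "y \<noteq> c" "x \<noteq> y"
    using one_nbr[of p q a] one_nbr[of p q c] distinct sym by metis
  have "\<not> E x b" using C4_free[of x b c d] xy assms distinct sym by blast
  moreover have "\<not> E x c"
    using one_nbr[of x y c] xy sym irrefl assms(3) by blast
  ultimately have "E y x \<or> E y b"
    using neighbour_of_P4_end[of x a b c y] xy assms sym by blast
  \<comment> \<open>The two cases close the 4-cycles \<open>y x d c\<close> and
    \<open>y b c d\<close>.\<close>
  then show False
    using C4_free[of y x d c] C4_free[of y b c d] C4_free[of y x a b] C4_free[of c d x y]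
      xy assms distinct sym irrefl by metis
qed

text \<open>The edgeless relation satisfies all the assumptions, so the contradiction can only start
  from an edge.\<close>

lemma no_edge: "\<not> E u v"
proof
  assume "E u v"
  then obtain x y where xy: "x \<noteq> y" "x \<noteq> u" "y \<noteq> u" "E v x" "E v y"
    using two_further_neighbours by blast
  have "\<not> (E u x \<and> E u y)"
    using C4_free[of v x u y] xy \<open>E u v\<close> irrefl sym by metis
  \<comment> \<open>\<open>u\<close> misses \<open>x\<close> or \<open>y\<close>, and that pair
    serves as \<open>a\<close> and \<open>b\<close>.\<close>
  then obtain a b where ab: "E v a" "E v b" "a \<noteq> b" "\<not> E a b"
    using xy \<open>E u v\<close> sym by metis
  obtain p q where pq: "p \<noteq> q" "p \<noteq> v" "q \<noteq> v" "E a p" "E a q"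
    using two_further_neighbours ab(1) by blast
  have "\<not> (E v p \<and> E v q)"
    using C4_free[of v p a q] pq ab irrefl sym by metis
  then obtain c where c: "E a c" "c \<noteq> v" "\<not> E v c"
    using pq by blast
  \<comment> \<open>This was the last possible chord of the path \<open>c a v b\<close>.\<close>
  have "\<not> E c b" using C4_free[of c a v b] c ab sym by metis
  then show False
    using no_induced_P4[of c a v b] c ab sym by metis
qed

end

text \<open>Sending each vertex of \<open>xs\<close> to its position is an isomorphism from the
  subgraph induced on \<open>xs\<close> to the path.\<close>

lemma (in nomulti_digraph) not_induced_free_path:
  assumes "distinct xs" "set xs \<subseteq> verts G"
    and "\<And>i j. i < length xs \<Longrightarrow> j < length xs \<Longrightarrow>
      xs ! i \<rightarrow>\<^bsub>G\<^esub> xs ! j \<longleftrightarrow> j = Suc i \<or> i = Suc j"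
  shows "\<not> induced_free G (with_proj (path_graph (length xs)))"
proof -
  define K where "K = G \<restriction> set xs"
  define f where "f = the_inv_into {..<length xs} ((!) xs)"
  \<comment> \<open>Arcs of the target are pairs of positions, hence the projections as new tail and
    head.\<close>
  define h where "h = \<lparr>iso_verts = f, iso_arcs = \<lambda>e. (f (tail G e), f (head G e)),
    iso_head = snd, iso_tail = fst\<rparr>"
  have inj: "inj_on ((!) xs) {..<length xs}"
    using assms(1) by (simp add: inj_on_nth)
  have f_nth: "f (xs ! i) = i" if "i < length xs" for i
    using the_inv_into_f_f[OF inj] that by (simp add: f_def)
  have bij: "bij_betw f (set xs) {..<length xs}"
    unfolding f_def by (rule bij_betw_the_inv_into) (use assms(1) in \<open>simp add: bij_betw_nth\<close>)
  then have f_inj: "inj_on f (set xs)" and f_img: "f ` set xs = {..<length xs}"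
    by (simp_all add: bij_betw_def)
  have K_simps: "verts K = set xs" "tail K = tail G" "head K = head G"
    "arcs K = {e \<in> arcs G. tail G e \<in> set xs \<and> head G e \<in> set xs}"
    by (simp_all add: K_def induce_subgraph_def)
  have K_ends: "arcs_ends K = {(u, v). u \<in> set xs \<and> v \<in> set xs \<and> u \<rightarrow>\<^bsub>G\<^esub> v}"
    by (auto simp: arcs_ends_conv K_simps)
  have "induced_subgraph K G"
    unfolding K_def by (rule induced_induce) (use assms(2) in auto)
  moreover have "pre_digraph.digraph_isomorphism K h"
    unfolding pre_digraph.digraph_isomorphism_def
  proof (intro conjI)
    show "wf_digraph K"
      by unfold_locales (auto simp: K_simps)
    \<comment> \<open>Arcs with equal images have equal ends, and there are no parallel
      arcs.\<close>
    show "inj_on (iso_arcs h) (arcs K)"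
      using f_inj by (auto simp: h_def K_simps inj_on_def arc_to_ends_def intro!: no_multi_arcs)
  qed (use f_inj in \<open>simp_all add: h_def K_simps\<close>)
  moreover have "with_proj (path_graph (length xs)) = app_iso h K"
  proof -
    have "iso_arcs h ` arcs K = map_prod f f ` arcs_ends K"
      by (simp add: h_def arcs_ends_conv K_simps image_image)
    also have "\<dots> = parcs (path_graph (length xs))"
      unfolding K_ends path_graph_def pair_pre_digraph.simps
    proof (intro equalityI subsetI)
      fix p assume "p \<in> map_prod f f ` {(u, v). u \<in> set xs \<and> v \<in> set xs \<and> u \<rightarrow>\<^bsub>G\<^esub> v}"
      then obtain i j where "i < length xs" "j < length xs" "xs ! i \<rightarrow>\<^bsub>G\<^esub> xs ! j"
        "p = (f (xs ! i), f (xs ! j))"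
        by (auto simp: in_set_conv_nth)
      then show "p \<in> {(i, j). i < length xs \<and> j < length xs \<and> (j = Suc i \<or> i = Suc j)}"
        using assms(3) by (simp add: f_nth)
    next
      fix p assume "p \<in> {(i, j). i < length xs \<and> j < length xs \<and> (j = Suc i \<or> i = Suc j)}"
      then obtain i j where ij: "p = (i, j)" "i < length xs" "j < length xs" "j = Suc i \<or> i = Suc j"
        by blast
      then show "p \<in> map_prod f f ` {(u, v). u \<in> set xs \<and> v \<in> set xs \<and> u \<rightarrow>\<^bsub>G\<^esub> v}"
        using assms(3)[of i j]
        by (intro image_eqI[of _ _ "(xs ! i, xs ! j)"]) (auto simp: f_nth)
    qed
    finally show ?thesis
      using f_img by (simp add: app_iso_def with_proj_def K_simps h_def path_graph_def)
  qed
  ultimately show ?thesis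
    unfolding induced_free_def digraph_iso_def by blast
qed

text \<open>A \<open>cycle\<close> is a list of arcs, so one arc is chosen for each
  adjacency.\<close>

lemma (in wf_digraph) dominates_cycle4:
  assumes "a \<rightarrow>\<^bsub>G\<^esub> b" "b \<rightarrow>\<^bsub>G\<^esub> c" "c \<rightarrow>\<^bsub>G\<^esub> d" "d \<rightarrow>\<^bsub>G\<^esub> a" "distinct [a, b, c, d]"
  shows "\<exists>p. cycle p \<and> length p = 4"
proof -
  obtain e1 e2 e3 e4 where
    "e1 \<in> arcs G" "tail G e1 = a" "head G e1 = b" "e2 \<in> arcs G" "tail G e2 = b" "head G e2 = c"
    "e3 \<in> arcs G" "tail G e3 = c" "head G e3 = d" "e4 \<in> arcs G" "tail G e4 = d" "head G e4 = a"
    using assms(1-4) by (auto simp: arcs_ends_conv)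
  moreover from this have "a \<in> verts G" by auto
  ultimately have "cycle [e1, e2, e3, e4]"
    using assms(5) unfolding cycle_def awalk_def by (intro exI[of _ a]) auto
  then show ?thesis by (intro exI[of _ "[e1, e2, e3, e4]"]) simp
qed

text \<open>Without parallel arcs, \<open>head G\<close> is injective on the arcs leaving
  \<open>v\<close>.\<close>

lemma (in nomulti_digraph) out_degree_eq_card_dominated:
  "out_degree G v = card {w. v \<rightarrow>\<^bsub>G\<^esub> w}"
proof -
  have "inj_on (head G) (out_arcs G v)"
    by (auto simp: inj_on_def out_arcs_def arc_to_ends_def intro!: no_multi_arcs)
  moreover have "head G ` out_arcs G v = {w. v \<rightarrow>\<^bsub>G\<^esub> w}"
    by (auto simp: out_arcs_def arcs_ends_conv)
  ultimately show ?thesis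
    unfolding out_degree_def by (metis card_image)
qed

theorem theorem1p1:
  fixes G :: "('a, 'b) pre_digraph"
  assumes "graph G"
    and "verts G \<noteq> {}"
    and "induced_free G (with_proj (path_graph 5))"
    and "\<forall>v \<in> verts G. out_degree G v \<ge> 3"
  shows "\<exists>p. pre_digraph.cycle G p \<and> length p = 4"
proof (rule ccontr)
  assume no_cycle: "\<not> ?thesis"
  interpret graph G by fact
  define E where "E u v \<longleftrightarrow> u \<rightarrow>\<^bsub>G\<^esub> v" for u v
  have E_verts: "u \<in> verts G" "v \<in> verts G" if "E u v" for u v
    using that by (auto simp: E_def arcs_ends_conv)
  have sym: "E v u" if "E u v" for u v
    using that unfolding E_def by (rule graph_symmetric)
  have irrefl: "\<not> E u u" for u
    using no_loops by (force simp: E_def arcs_ends_conv)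
  have C4_free: "a = c \<or> b = d" if "E a b" "E b c" "E c d" "E d a" for a b c d
  proof (rule ccontr)
    assume "\<not> ?thesis"
    then have "distinct [a, b, c, d]"
      using that irrefl by auto
    then show False
      using dominates_cycle4 that no_cycle unfolding E_def by blast
  qed
  have P5_free: "E a e"
    if that: "E a b" "E b c" "E c d" "E d e" "\<not> E a c" "\<not> E a d" "\<not> E b d" "\<not> E b e" "\<not> E c e"
    for a b c d e
  proof (rule ccontr)
    assume nonadj: "\<not> E a e"
    let ?xs = "[a, b, c, d, e]"
    have nonedges: "\<not> E c a" "\<not> E d a" "\<not> E d b" "\<not> E e b" "\<not> E e c" "\<not> E e a"
      using that nonadj sym by blast+
    have edges: "E b a" "E c b" "E d c" "E e d"
      using that sym by blast+
    note E_xs = edges nonedges that nonadj irrefl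
    have "distinct ?xs"
      using that nonadj sym irrefl by auto
    moreover have "set ?xs \<subseteq> verts G"
      using that E_verts by auto
    moreover have "?xs ! i \<rightarrow>\<^bsub>G\<^esub> ?xs ! j \<longleftrightarrow> j = Suc i \<or> i = Suc j"
      if "i < length ?xs" "j < length ?xs" for i j
    proof -
      \<comment> \<open>The 25 index pairs are checked one by one.\<close>
      have "i \<in> {0, 1, 2, 3, 4}" "j \<in> {0, 1, 2, 3, 4}"
        using that by auto
      then show ?thesis
        unfolding E_def[symmetric] by (elim insertE emptyE) (simp_all add: E_xs)
    qed
    ultimately have "\<not> induced_free G (with_proj (path_graph (length ?xs)))"
      by (rule not_induced_free_path)
    then show False
      using assms(3) by (simp add: eval_nat_numeral)
  qed
  have card_nbrs: "3 \<le> card {w. E v w}" if "v \<in> verts G" for v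
    using assms(4) that unfolding E_def by (simp add: out_degree_eq_card_dominated)
  have two_further_neighbours: "\<exists>x y. x \<noteq> y \<and> x \<noteq> u \<and> y \<noteq> u \<and> E v x \<and> E v y" if "E u v" for u v
  proof -
    \<comment> \<open>At least two of the three neighbours of \<open>v\<close> survive the removal
      of \<open>u\<close>; the successor form lets \<open>card_le_Suc_iff\<close> extract
      them.\<close>
    have "Suc (Suc 0) \<le> card ({w. E v w} - {u})"
      using card_nbrs[of v] E_verts(2)[OF that] by (auto simp: card_Diff_singleton_if)
    then show ?thesis
      by (auto simp: card_le_Suc_iff)
  qed
  obtain v where "v \<in> verts G"
    using assms(2) by blast
  \<comment> \<open>The degree bound at a single vertex supplies the edge that
    \<open>no_edge\<close> rules out.\<close>
  then have "{w. E v w} \<noteq> {}"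
    using card_nbrs[of v] by (metis card.empty not_numeral_le_zero)
  moreover have "\<not> E u w" for u w
    by (rule no_edge[of E]; fact sym irrefl C4_free P5_free two_further_neighbours)
  ultimately show False by blast
qed

end
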